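(* Let $a$ and $n$ be positive integers, let $\varepsilon = [n \not\equiv 0 \pmod{3}]$, and let $A = \left\lfloor \frac{(2^a - 1)n}{3\cdot 2^{\nu_2 (n)}} \right\rfloor$. Then: (i) If $a$ is even, then $$\nu_2 \left( {2^a n \choose n}_F \right) = \delta + A - \frac{a}{2}\varepsilon - \nu_2 (A!) = \delta + s_2 (A) - \frac{a}{2}\varepsilon,$$ where $\delta = 1$ if $n \equiv 3,5 \pmod{6}$ and $\delta = 0$ otherwise. (ii) If $a$ is odd, then $$\nu_2 \left( {2^a n \choose n}_F \right) = \delta + A - \frac{a-1}{2}\varepsilon - \nu_2 (A!) = \delta + s_2 (A) - \frac{a-1}{2}\varepsilon,$$ where $\delta = \frac{(n\bmod 6) - 1}{2}\,[2\nmid n] + \left\lceil \frac{\nu_2 (n) + 3 - (n \bmod 3)}{2} \right\rceil [n \bmod 6 \in\{2,4\}]$; equivalently, $\delta = \frac{(n \bmod 6) - 1}{2}$ if $n$ is odd, $\delta = 0$ if $n \equiv 0 \pmod{6}$, $\delta = \left\lceil \frac{\nu_2 (n)}{2} \right\rceil + 1$ if $n \equiv 4 \pmod{6}$, and $\delta = \left\lceil \frac{\nu_2 (n) + 1}{2} \right\rceil$ if $n \equiv 2 \pmod{6}$.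
   Context: The Fibonacci sequence is $F_1=F_2=1$, $F_n=F_{n-1}+F_{n-2}$ for $n\ge 3$. For $m\ge 1$ and $1\le k\le m$ the Fibonomial coefficient is ${m \choose k}_F = \frac{F_1F_2\cdots F_m}{(F_1\cdots F_k)(F_1\cdots F_{m-k})}$ (an integer), with ${m\choose 0}_F=1$ and ${m\choose k}_F=0$ for $k>m$. $\nu_p(x)$ denotes the exponent of the prime $p$ in $x$. $s_q(n)$ is the sum of the base-$q$ digits of $n$. $[P]$ is the Iverson bracket ($1$ if $P$ holds, $0$ otherwise). $a \bmod m$ is the least nonnegative residue of $a$ modulo $m$. *)

theory Defs
  imports Complex_Main "HOL-Number_Theory.Number_Theory"
begin

(* The division is exact: see fibonomial_exact below. *)
definition fibonomial :: "nat \<Rightarrow> nat \<Rightarrow> nat" where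
  "fibonomial m k =
     (if k \<le> m
      then (\<Prod>i=1..m. fib i) div ((\<Prod>i=1..k. fib i) * (\<Prod>i=1..m - k. fib i))
      else 0)"

(* For q \<ge> 2 the digits at positions i > n vanish, since n < q ^ i there. *)
definition digit_sum :: "nat \<Rightarrow> nat \<Rightarrow> nat" where
  "digit_sum q n = (\<Sum>i\<le>n. n div q ^ i mod q)"

lemma prod_fib_pos: "(\<Prod>i=1..m. fib i) > 0"
  by (intro prod_pos) (auto simp: fib_neq_0_nat)

lemma prod_fib_dvd:
  "(\<Prod>i=1..k. fib i) * (\<Prod>i=1..j. fib i) dvd (\<Prod>i=1..k + j. fib i)"
proof (induction "k + j" arbitrary: k j)
  case 0
  then show ?case by simp
next
  case (Suc s)
  show ?case
  proof (cases "k = 0 \<or> j = 0")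
    case True
    then show ?thesis by auto
  next
    case False
    then obtain k' j' where kj: "k = Suc k'" "j = Suc j'"
      by (metis not0_implies_Suc)
    let ?P = "\<lambda>m. \<Prod>i=1..m. fib i"
    have S: "?P (Suc m) = fib (Suc m) * ?P m" for m
      by (simp add: mult.commute)
    have s: "k + j = Suc s" "s = k' + j" "s = k + j'"
      using Suc.hyps(2) kj by auto
    have "?P k' * ?P j dvd ?P s" "?P k * ?P j' dvd ?P s"
      using Suc.hyps(1)[OF s(2)] Suc.hyps(1)[OF s(3)] by (simp_all only: s(2)[symmetric] s(3)[symmetric])
    hence "fib k * (?P k' * ?P j) dvd fib k * ?P s" "fib j * (?P k * ?P j') dvd fib j * ?P s"
      by (auto intro: mult_dvd_mono)
    hence 1: "?P k * ?P j dvd fib k * ?P s" and 2: "?P k * ?P j dvd fib j * ?P s"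
      unfolding kj S by (simp_all only: ac_simps)
    have "fib (Suc s) = fib (Suc j) * fib k + fib j * fib k'"
      using fib_add[of k' j] s kj by simp
    hence "?P (k + j) = fib (Suc j) * (fib k * ?P s) + fib k' * (fib j * ?P s)"
      unfolding s(1) S by (simp add: algebra_simps)
    with 1 2 show ?thesis
      by (metis dvd_add dvd_mult)
  qed
qed

lemma fibonomial_exact:
  assumes "k \<le> m"
  shows "real (fibonomial m k) =
    real (\<Prod>i=1..m. fib i) / (real (\<Prod>i=1..k. fib i) * real (\<Prod>i=1..m - k. fib i))"
  using assms prod_fib_dvd[of k "m - k"]
  by (simp add: fibonomial_def real_of_nat_div del: of_nat_prod)

lemma fibonomial_0 [simp]: "fibonomial m 0 = 1"
  using prod_fib_pos[of m] by (simp add: fibonomial_def)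

lemma digit_sum_digit_zero:
  assumes "q \<ge> 2" "i > n"
  shows "n div q ^ i mod q = 0"
proof -
  have "n < q ^ n" using assms(1) by (intro less_exp[THEN order.strict_trans2] power_mono) auto
  also have "q ^ n \<le> q ^ i" using assms by (intro power_increasing) auto
  finally show ?thesis by simp
qed

end

theory Submission
  imports Defs
begin

text \<open>
  Write \<open>s\<close> for the binary digit sum. Since \<open>F\<^sub>m\<close> is even exactly when \<open>3\<close> divides \<open>m\<close>, and the
  \<open>2\<close>-adic valuation of \<open>F\<^sub>3\<^sub>j\<close> is that of \<open>j\<close> plus \<open>1\<close> (\<open>j\<close> odd) or \<open>2\<close> (\<open>j\<close> even), Legendre's formula
  shows that \<open>F\<^sub>1 \<cdots> F\<^sub>m\<close> has valuation \<open>2 M + \<lfloor>M / 2\<rfloor> - s M\<close> with \<open>M = \<lfloor>m / 3\<rfloor>\<close>. It remains to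
  compare the digit sums of \<open>\<lfloor>x / 3\<rfloor>\<close> and \<open>\<lfloor>2\<^sup>v x / 3\<rfloor>\<close>: the second number is the first one shifted by
  \<open>v\<close> digits, with the leading \<open>v\<close> digits of the fractional part of \<open>x / 3\<close> (which alternate)
  filled in. This is applied to \<open>2\<^sup>a n\<close> and to \<open>(2\<^sup>a - 1) n\<close>.
\<close>

section \<open>Binary digit sums\<close>

lemma digit_sum_two_double_add:
  assumes "b < 2"
  shows "digit_sum 2 (2 * m + b) = digit_sum 2 m + b"
proof -
  let ?n = "2 * m + b"
  \<comment> \<open>The summation range depends on the argument: one extra vanishing digit lets the
    lowest digit be split off, and the vanishing digits beyond \<open>m\<close> are dropped
    afterwards.\<close>
  have "digit_sum 2 ?n = (\<Sum>i\<le>Suc ?n. ?n div 2 ^ i mod 2)"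
    using digit_sum_digit_zero[of 2 ?n "Suc ?n"] by (simp add: digit_sum_def)
  also have "\<dots> = ?n mod 2 + (\<Sum>i\<le>?n. ?n div 2 ^ Suc i mod 2)"
    by (subst sum.atMost_Suc_shift) simp
  also have "(\<Sum>i\<le>?n. ?n div 2 ^ Suc i mod 2) = (\<Sum>i\<le>?n. m div 2 ^ i mod 2)"
    using assms by (intro sum.cong) (auto simp: div_mult2_eq)
  also have "\<dots> = (\<Sum>i\<le>m. m div 2 ^ i mod 2)"
    by (rule sum.mono_neutral_right) (use digit_sum_digit_zero[of 2 m] in auto)
  also have "?n mod 2 = b"
    using assms by simp
  finally show ?thesis
    by (simp add: digit_sum_def)
qed

lemma digit_sum_two_double: "digit_sum 2 (2 * m) = digit_sum 2 m"
  using digit_sum_two_double_add[of 0 m] by simp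

lemma digit_sum_two_Suc_double: "digit_sum 2 (Suc (2 * m)) = Suc (digit_sum 2 m)"
  using digit_sum_two_double_add[of 1 m] by simp

text \<open>Adding one turns the trailing ones of \<open>m\<close> into zeros and the zero above
  them into a one; the number of trailing ones is the valuation of \<open>Suc m\<close>.\<close>

lemma digit_sum_two_Suc:
  "digit_sum 2 (Suc m) + multiplicity 2 (Suc m) = Suc (digit_sum 2 m)"
proof (induction m rule: less_induct)
  case (less m)
  show ?case
  proof (cases "even m")
    case True
    then obtain k where k: "m = 2 * k" by blast
    then show ?thesis
      by (simp add: digit_sum_two_double digit_sum_two_Suc_double not_dvd_imp_multiplicity_0)
  next
    case False
    then obtain k where k: "m = Suc (2 * k)" by (auto elim!: oddE)
    then have "Suc m = 2 * Suc k" by simp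
    moreover have "multiplicity 2 (2 * Suc k) = Suc (multiplicity 2 (Suc k))"
      by (rule multiplicity_times_same) auto
    ultimately show ?thesis
      using less.IH[of k] k
      by (simp only: digit_sum_two_double digit_sum_two_Suc_double) simp
  qed
qed

text \<open>Legendre's formula for the prime 2, obtained by telescoping
  \<open>digit_sum_two_Suc\<close>.\<close>

lemma digit_sum_two_add_multiplicity_fact:
  "digit_sum 2 m + multiplicity 2 (fact m :: nat) = m"
proof (induction m)
  case 0
  then show ?case by (simp add: digit_sum_def)
next
  case (Suc m)
  have "multiplicity 2 (fact (Suc m) :: nat) = multiplicity 2 (Suc m) + multiplicity 2 (fact m :: nat)"
    unfolding fact_Suc of_nat_id
    by (rule prime_elem_multiplicity_mult_distrib) auto
  then show ?case
    using Suc digit_sum_two_Suc[of m] by simp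
qed

text \<open>In binary, 1/3 = 0.0101... and 2/3 = 0.1010..., so the first \<open>v\<close> digits
  contain \<open>v div 2\<close> and \<open>(v + 1) div 2\<close> ones respectively. Each doubling
  of \<open>x\<close> emits one digit and swaps the residues 1 and 2.\<close>

lemma digit_sum_two_shift_div_3:
  "digit_sum 2 (2 ^ v * x div 3) =
    digit_sum 2 (x div 3) + (if x mod 3 = 0 then 0 else (v + x mod 3 - 1) div 2)"
proof (induction v arbitrary: x)
  case 0
  have "x mod 3 < 3" by simp
  then show ?case by (auto simp: div_eq_0_iff)
next
  case (Suc v)
  have IH: "digit_sum 2 (2 ^ Suc v * x div 3) =
    digit_sum 2 (2 * x div 3) + (if 2 * x mod 3 = 0 then 0 else (v + 2 * x mod 3 - 1) div 2)"
    using Suc.IH[of "2 * x"] by (simp add: ac_simps)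
  consider "x mod 3 = 0" | "x mod 3 = 1" | "x mod 3 = 2" by linarith
  then show ?case
  proof cases
    case 1
    then have "2 * x div 3 = 2 * (x div 3)" "2 * x mod 3 = 0" by presburger+
    then show ?thesis unfolding IH using 1 by (simp add: digit_sum_two_double)
  next
    case 2
    then have "2 * x div 3 = 2 * (x div 3)" "2 * x mod 3 = 2" by presburger+
    then show ?thesis unfolding IH using 2 by (simp add: digit_sum_two_double)
  next
    case 3
    then have "2 * x div 3 = Suc (2 * (x div 3))" "2 * x mod 3 = 1" by presburger+
    then show ?thesis unfolding IH using 3 by (simp add: digit_sum_two_Suc_double)
  qed
qed

section \<open>The 2-adic valuation of Fibonacci numbers\<close>

lemma fib_3: "fib 3 = 2" and fib_6: "fib 6 = 8" and fib_12: "fib 12 = 144"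
  by (simp_all add: eval_nat_numeral)

lemma even_fib_iff: "even (fib n) \<longleftrightarrow> 3 dvd n"
proof -
  have *: "gcd 2 (fib n) = fib (gcd 3 n)"
    using fib_gcd[of 3 n] by (simp add: fib_3)
  have "gcd 3 n dvd 3" by simp
  then have "gcd 3 n = 1 \<or> gcd 3 n = 3"
    using prime_nat_iff[of 3] by auto
  then show ?thesis
    unfolding gcd_nat.absorb_iff1[of _ "fib n"] gcd_nat.absorb_iff1[of _ n] *
    by (elim disjE) (simp_all add: fib_3)
qed

text \<open>The cofactor of \<open>fib n\<close> in \<open>fib (2 * n)\<close> is the Lucas number
  \<open>fib (n + 1) + fib (n - 1)\<close>. As 8 divides \<open>fib n\<close> and
  \<open>fib (n - 1)\<close> is odd, it is twice an odd number.\<close>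

lemma multiplicity_two_fib_double:
  assumes "6 dvd n" "n > 0"
  shows "multiplicity 2 (fib (2 * n)) = Suc (multiplicity 2 (fib n))"
proof -
  obtain m where m: "n = Suc m" using assms(2) by (cases n) auto
  have "fib (Suc m + n) = fib (Suc n) * fib (Suc m) + fib n * fib m"
    using fib_add[of m n] by simp
  then have eq: "fib (2 * n) = fib n * (fib (Suc n) + fib m)"
    unfolding mult_2 using m by (simp add: algebra_simps del: fib.simps add_Suc add_Suc_right)
  have "8 dvd fib n"
    using fib_gcd[of 6 n] assms(1) by (metis fib_6 gcd_nat.absorb_iff1 gcd_dvd2)
  then obtain q where q: "fib n = 8 * q" by blast
  have "fib (Suc n) = fib n + fib m" using m by simp
  then have sum: "fib (Suc n) + fib m = 2 * (fib m + 4 * q)" using q by simp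
  have "\<not> 3 dvd m" using assms m by presburger
  then have "odd (fib m + 4 * q)" by (simp add: even_fib_iff)
  then have "multiplicity 2 (2 * (fib m + 4 * q)) = Suc 0"
    by (subst multiplicity_times_same) (auto simp: not_dvd_imp_multiplicity_0 intro!: Nat.gr0I)
  moreover have "fib n > 0" using assms(2) by (simp add: fib_neq_0_nat)
  moreover have "fib m + 4 * q \<noteq> 0" using \<open>odd (fib m + 4 * q)\<close> by (metis dvd_0_right)
  ultimately show ?thesis
    unfolding eq sum by (subst prime_elem_multiplicity_mult_distrib) auto
qed

lemma multiplicity_two_fib_mult_6:
  assumes "j > 0"
  shows "multiplicity 2 (fib (6 * j)) = multiplicity 2 j + 3"
  using assms
proof (induction j rule: less_induct)
  case (less j)
  show ?case
  proof (cases "even j")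
    case True
    then obtain k where k: "j = 2 * k" by blast
    then have "k > 0" "k < j" using less.prems by auto
    moreover have "multiplicity 2 (2 * k) = Suc (multiplicity 2 k)"
      using \<open>k > 0\<close> by (intro multiplicity_times_same) auto
    ultimately show ?thesis
      using less.IH[of k] multiplicity_two_fib_double[of "6 * k"] k by (simp add: ac_simps)
  next
    case False
    \<comment> \<open>Comparison with \<open>fib 12 = 144\<close>, a multiple of 16: the gcd with
      \<open>fib (6 * j)\<close> is \<open>fib 6 = 8\<close>, which fixes the valuation at
      3.\<close>
    then have "gcd (6 * j) (6 * 2) = 6 * gcd j 2"
      using gcd_mult_distrib_nat[of 6 j 2] by simp
    also have "gcd j 2 = 1"
      using False by (simp add: coprime_iff_gcd_eq_1[symmetric])
    finally have "gcd (fib (6 * j)) 144 = 8"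
      using fib_gcd[of "6 * j" 12] by (simp add: fib_6 fib_12)
    then have "8 dvd fib (6 * j)" "\<not> 16 dvd fib (6 * j)"
      by (metis gcd_dvd1) (use \<open>gcd (fib (6 * j)) 144 = 8\<close> gcd_greatest[of 16 "fib (6 * j)" 144] in auto)
    then have "multiplicity 2 (fib (6 * j)) = 3"
      by (intro multiplicity_eqI) auto
    then show ?thesis using False by (simp add: not_dvd_imp_multiplicity_0)
  qed
qed

lemma multiplicity_two_fib_mult_3:
  assumes "j > 0"
  shows "multiplicity 2 (fib (3 * j)) = multiplicity 2 j + (if even j then 2 else 1)"
proof (cases "even j")
  case True
  then obtain k where k: "j = 2 * k" by blast
  then have "k > 0" using assms by auto
  then have "multiplicity 2 (2 * k) = Suc (multiplicity 2 k)"
    by (intro multiplicity_times_same) auto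
  then show ?thesis
    using multiplicity_two_fib_mult_6[OF \<open>k > 0\<close>] k by simp
next
  case False
  \<comment> \<open>The same device with \<open>fib 6 = 8\<close>: the gcd is
    \<open>fib 3 = 2\<close>, so 4 cannot divide \<open>fib (3 * j)\<close>.\<close>
  then have "gcd (3 * j) (3 * 2) = 3 * gcd j 2"
    using gcd_mult_distrib_nat[of 3 j 2] by simp
  also have "gcd j 2 = 1"
    using False by (simp add: coprime_iff_gcd_eq_1[symmetric])
  finally have g: "gcd (fib (3 * j)) 8 = 2"
    using fib_gcd[of "3 * j" 6] by (simp add: fib_3 fib_6)
  then have "2 dvd fib (3 * j)" "\<not> 4 dvd fib (3 * j)"
    by (metis gcd_dvd1) (use g gcd_greatest[of 4 "fib (3 * j)" 8] in auto)
  then have "multiplicity 2 (fib (3 * j)) = 1"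
    by (intro multiplicity_eqI) auto
  then show ?thesis using False by (simp add: not_dvd_imp_multiplicity_0)
qed

section \<open>Products of Fibonacci numbers and Fibonomial coefficients\<close>

lemma multiplicity_two_prod_fib:
  "multiplicity 2 (\<Prod>i=1..m. fib i) + digit_sum 2 (m div 3) = 2 * (m div 3) + m div 3 div 2"
proof (induction m)
  case 0
  then show ?case by (simp add: digit_sum_def)
next
  case (Suc m)
  have "multiplicity 2 ((\<Prod>i=1..m. fib i) * fib (Suc m)) =
      multiplicity 2 (\<Prod>i=1..m. fib i) + multiplicity 2 (fib (Suc m))"
    using prod_fib_pos[of m] fib_neq_0_nat[of "Suc m"]
    by (intro prime_elem_multiplicity_mult_distrib) auto
  then have step: "multiplicity 2 (\<Prod>i=1..Suc m. fib i) =
      multiplicity 2 (\<Prod>i=1..m. fib i) + multiplicity 2 (fib (Suc m))"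
    by simp
  \<comment> \<open>Only indices divisible by 3 contribute. For these, the valuation of
    \<open>Suc k\<close> is absorbed by the change of the digit sum, and the extra 1 or 2 by the
    change of the right-hand side.\<close>
  show ?case
  proof (cases "3 dvd Suc m")
    case False
    then have "Suc m div 3 = m div 3" by presburger
    then show ?thesis
      using Suc step False by (simp add: not_dvd_imp_multiplicity_0 even_fib_iff)
  next
    case True
    define k where "k = m div 3"
    have k: "Suc m = 3 * Suc k" "Suc m div 3 = Suc k" using True unfolding k_def by presburger+
    have "multiplicity 2 (fib (Suc m)) = multiplicity 2 (Suc k) + (if even (Suc k) then 2 else 1)"
      unfolding k(1) by (rule multiplicity_two_fib_mult_3) simp
    moreover have "Suc k div 2 = k div 2 + (if even (Suc k) then 1 else 0)"
      by auto
    ultimately show ?thesis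
      using Suc.IH digit_sum_two_Suc[of k] unfolding step k(2) k_def[symmetric]
      by (simp split: if_splits)
  qed
qed

text \<open>The valuation formula for the three products, with all negative terms moved across to
  avoid truncated subtraction.\<close>

lemma multiplicity_two_fibonomial:
  assumes "k \<le> m"
  shows "multiplicity 2 (fibonomial m k)
      + (2 * (k div 3) + k div 3 div 2) + (2 * ((m - k) div 3) + (m - k) div 3 div 2)
      + digit_sum 2 (m div 3)
    = 2 * (m div 3) + m div 3 div 2 + digit_sum 2 (k div 3) + digit_sum 2 ((m - k) div 3)"
proof -
  let ?P = "\<lambda>m. \<Prod>i=1..m. fib i"
  have eq: "?P m = fibonomial m k * (?P k * ?P (m - k))"
    using prod_fib_dvd[of k "m - k"] assms by (simp add: fibonomial_def)
  have nz: "?P i \<noteq> 0" for i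
    using prod_fib_pos[of i] by simp
  then have "fibonomial m k \<noteq> 0"
    using eq by (metis mult_0)
  then have "multiplicity 2 (fibonomial m k * (?P k * ?P (m - k))) =
      multiplicity 2 (fibonomial m k) + (multiplicity 2 (?P k) + multiplicity 2 (?P (m - k)))"
    using nz by (simp only: prime_elem_multiplicity_mult_distrib[OF prime_imp_prime_elem[OF two_is_prime_nat]]
        mult_eq_0_iff simp_thms)
  then show ?thesis
    using multiplicity_two_prod_fib[of m] multiplicity_two_prod_fib[of k]
      multiplicity_two_prod_fib[of "m - k"] unfolding eq[symmetric] by linarith
qed

section \<open>The coefficients with upper index \<open>2 ^ a * n\<close>\<close>

lemma even_power_two_times_mod_3:
  "even a \<Longrightarrow> 2 ^ a * n mod 3 = n mod (3::nat)"
proof (elim evenE)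
  fix c assume "a = 2 * c"
  moreover have "[(4::nat) ^ c = 1 ^ c] (mod 3)"
    by (intro cong_pow) (simp add: cong_def)
  ultimately show ?thesis
    using cong_scalar_right[of "4 ^ c" 1 3 n] by (simp add: power_mult cong_def)
qed

lemma odd_power_two_times_mod_3:
  "odd a \<Longrightarrow> 2 ^ a * n mod 3 = 2 * n mod (3::nat)"
  using even_power_two_times_mod_3[of "a - 1" "2 * n"]
  by (cases a) (simp_all add: ac_simps)

text \<open>The theorem over the naturals. The digit-sum shift is applied to \<open>N\<close> as
  \<open>n\<close> shifted by \<open>a\<close>, which yields the term \<open>a div 2\<close>, and to
  \<open>K = N - n\<close> as \<open>X\<close> shifted by \<open>v\<close>, which yields
  \<open>A\<close>.\<close>

lemma multiplicity_two_fibonomial_power_two: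
  fixes a n :: nat
  defines "v \<equiv> multiplicity 2 n"
  defines "A \<equiv> (2 ^ a - 1) * (n div 2 ^ v) div 3"
  assumes "a > 0" "n > 0"
  shows "even a \<Longrightarrow> multiplicity 2 (fibonomial (2 ^ a * n) n) + a div 2 * of_bool (\<not> 3 dvd n)
      = of_bool (n mod 6 \<in> {3, 5}) + digit_sum 2 A"
    and "odd a \<Longrightarrow> multiplicity 2 (fibonomial (2 ^ a * n) n) + a div 2 * of_bool (\<not> 3 dvd n)
      = (if odd n then n mod 6 div 2 else if n mod 6 = 0 then 0
         else if n mod 6 = 4 then (v + 1) div 2 + 1 else (v + 2) div 2) + digit_sum 2 A"
proof -
  define N where "N = 2 ^ a * n"
  define K where "K = N - n"
  define X where "X = (2 ^ a - 1) * (n div 2 ^ v)"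
  have "n \<le> N" unfolding N_def by simp
  have NK: "N = K + n" using \<open>n \<le> N\<close> unfolding K_def by simp
  have n: "n = 2 ^ v * (n div 2 ^ v)"
    unfolding v_def by (simp add: multiplicity_dvd)
  have "K = (2 ^ a - 1) * n"
    unfolding K_def N_def by (simp add: diff_mult_distrib)
  then have KX: "K = 2 ^ v * X"
    unfolding X_def using n by (metis mult.left_commute)
  have "even N" using assms(3) unfolding N_def by simp
  have v0: "v = 0 \<longleftrightarrow> odd n"
    unfolding v_def using assms(4) by (auto simp: multiplicity_eq_zero_iff)
  define g where "g x = 2 * x + x div 2" for x :: nat
  have main: "multiplicity 2 (fibonomial N n) + g (n div 3) + g (K div 3) + digit_sum 2 (N div 3)
      = g (N div 3) + digit_sum 2 (n div 3) + digit_sum 2 (K div 3)"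
    using multiplicity_two_fibonomial[OF \<open>n \<le> N\<close>] unfolding g_def K_def .
  have sN: "digit_sum 2 (N div 3) =
      digit_sum 2 (n div 3) + (if n mod 3 = 0 then 0 else (a + n mod 3 - 1) div 2)"
    unfolding N_def by (rule digit_sum_two_shift_div_3)
  have sK: "digit_sum 2 (K div 3) =
      digit_sum 2 A + (if X mod 3 = 0 then 0 else (v + X mod 3 - 1) div 2)"
    unfolding KX A_def X_def[symmetric] by (rule digit_sum_two_shift_div_3)
  \<comment> \<open>Since 2 is -1 modulo 3, \<open>K\<close> is congruent to \<open>X\<close> for
    even \<open>v\<close>; for odd \<open>v\<close> one more doubling returns to
    \<open>X\<close>.\<close>
  have XK: "X mod 3 = (if even v then K mod 3 else 2 * (K mod 3) mod 3)"
    using even_power_two_times_mod_3[of v X] even_power_two_times_mod_3[of "Suc v" X]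
    by (simp add: KX mod_mult_right_eq mult.assoc)
  have "even K \<longleftrightarrow> even n" using \<open>even N\<close> NK by simp
  have par: "odd m \<longleftrightarrow> odd (m div 3) \<noteq> odd (m mod 3)" for m :: nat
    by (subst mult_div_mod_eq[of 3 m, symmetric]) (simp only: even_add even_mult_iff, simp)
  have Nd: "N div 3 = K div 3 + n div 3 + (K mod 3 + n mod 3) div 3"
    unfolding NK by (rule div_add1_eq)
  \<comment> \<open>\<open>g x\<close> is the floor of 5x/2, so it is additive up to a rounding term
    determined by parities. The second form serves when the residues modulo 3 produce a
    carry.\<close>
  have g_add: "g (x + y) = g x + g y + of_bool (odd x \<and> odd y)"
    and g_Suc_add: "g (Suc (x + y)) = g x + g y + 2 + of_bool (odd x \<or> odd y)" for x y
    unfolding g_def by (auto elim!: evenE oddE)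
  {
    assume "even a"
    then obtain c where c: "a = 2 * c" by blast
    have N3: "N mod 3 = n mod 3"
      unfolding N_def using \<open>even a\<close> by (rule even_power_two_times_mod_3)
    then have "K mod 3 = 0" using NK cong_add_rcancel_nat[of K n 0 3] by (simp add: cong_def)
    then have "X mod 3 = 0" using XK by simp
    have "N div 3 = K div 3 + n div 3" using Nd \<open>K mod 3 = 0\<close> by simp
    moreover have "odd (K div 3) \<and> odd (n div 3) \<longleftrightarrow> n mod 6 \<in> {3, 5}"
    proof -
      have "odd (K div 3) \<longleftrightarrow> odd n"
        using par[of K] \<open>even K \<longleftrightarrow> even n\<close> \<open>K mod 3 = 0\<close> by simp
      moreover have "odd n \<and> odd (n div 3) \<longleftrightarrow> n mod 6 = 3 \<or> n mod 6 = 5" by presburger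
      ultimately show ?thesis by simp
    qed
    ultimately have "g (N div 3) = g (K div 3) + g (n div 3) + of_bool (n mod 6 \<in> {3, 5})"
      using g_add[of "K div 3" "n div 3"] by simp
    \<comment> \<open>For even \<open>a\<close> the residues 1 and 2 give the same count of
      ones.\<close>
    moreover have "(if n mod 3 = 0 then 0 else (a + n mod 3 - 1) div 2)
        = a div 2 * of_bool (\<not> 3 dvd n)"
    proof -
      have "n mod 3 = 0 \<or> n mod 3 = 1 \<or> n mod 3 = 2" by linarith
      then show ?thesis using c by (elim disjE) (simp_all add: dvd_eq_mod_eq_0)
    qed
    ultimately show "multiplicity 2 (fibonomial (2 ^ a * n) n) + a div 2 * of_bool (\<not> 3 dvd n)
      = of_bool (n mod 6 \<in> {3, 5}) + digit_sum 2 A"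
      using main sN sK \<open>X mod 3 = 0\<close> unfolding N_def[symmetric] by simp
  }
  {
    assume "odd a"
    then obtain c where c: "a = 2 * c + 1" by (elim oddE)
    have N3: "N mod 3 = 2 * n mod 3"
      unfolding N_def using \<open>odd a\<close> by (rule odd_power_two_times_mod_3)
    have K3: "K mod 3 = n mod 3"
      using N3 NK cong_add_rcancel_nat[of K n n 3] by (simp add: cong_def mult_2)
    consider "n mod 3 = 0" | "n mod 3 = 1" | "n mod 3 = 2" by linarith
    then show "multiplicity 2 (fibonomial (2 ^ a * n) n) + a div 2 * of_bool (\<not> 3 dvd n)
      = (if odd n then n mod 6 div 2 else if n mod 6 = 0 then 0
         else if n mod 6 = 4 then (v + 1) div 2 + 1 else (v + 2) div 2) + digit_sum 2 A"
    proof cases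
      case 1
      have N: "N div 3 = K div 3 + n div 3" unfolding Nd K3 1 by simp
      have "odd (K div 3) \<and> odd (n div 3) \<longleftrightarrow> odd n"
        using par[of n] par[of K] \<open>even K \<longleftrightarrow> even n\<close> unfolding K3 1 by auto
      then have gN: "g (N div 3) = g (K div 3) + g (n div 3) + of_bool (odd n)"
        unfolding N g_add by simp
      have n6: "n mod 6 = (if odd n then 3 else 0)" using 1 by presburger
      have "digit_sum 2 (N div 3) = digit_sum 2 (n div 3)"
        unfolding sN 1 by simp
      moreover have "digit_sum 2 (K div 3) = digit_sum 2 A"
        unfolding sK XK K3 1 by simp
      ultimately have "multiplicity 2 (fibonomial N n) = of_bool (odd n) + digit_sum 2 A"
        using main unfolding gN by simp
      then show ?thesis
        unfolding N_def[symmetric] n6 dvd_eq_mod_eq_0[of 3] 1 by simp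
    next
      case 2
      have N: "N div 3 = K div 3 + n div 3" unfolding Nd K3 2 by simp
      have "odd (K div 3) \<and> odd (n div 3) \<longleftrightarrow> even n"
        using par[of n] par[of K] \<open>even K \<longleftrightarrow> even n\<close> unfolding K3 2 by auto
      then have gN: "g (N div 3) = g (K div 3) + g (n div 3) + of_bool (even n)"
        unfolding N g_add by simp
      have n6: "n mod 6 = (if odd n then 1 else 4)" using 2 by presburger
      have "digit_sum 2 (N div 3) = digit_sum 2 (n div 3) + a div 2"
        unfolding sN 2 by simp
      \<comment> \<open>\<open>X mod 3\<close> is 1 for even \<open>v\<close> and 2 for odd
        \<open>v\<close>; the count is \<open>(v + 1) div 2\<close> either way.\<close>
      moreover have "digit_sum 2 (K div 3) = digit_sum 2 A + (v + 1) div 2"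
        unfolding sK XK K3 2 by auto
      ultimately have "multiplicity 2 (fibonomial N n) + a div 2
          = of_bool (even n) + digit_sum 2 A + (v + 1) div 2"
        using main unfolding gN by simp
      then show ?thesis
        unfolding N_def[symmetric] n6 dvd_eq_mod_eq_0[of 3] 2 using v0 by simp
    next
      case 3
      \<comment> \<open>Here the residues add up to 4, so a carry occurs.\<close>
      have N: "N div 3 = Suc (K div 3 + n div 3)" unfolding Nd K3 3 by simp
      have "odd (K div 3) \<or> odd (n div 3) \<longleftrightarrow> odd n"
        using par[of n] par[of K] \<open>even K \<longleftrightarrow> even n\<close> unfolding K3 3 by auto
      then have gN: "g (N div 3) = g (K div 3) + g (n div 3) + 2 + of_bool (odd n)"
        unfolding N g_Suc_add by simp
      have n6: "n mod 6 = (if odd n then 5 else 2)" using 3 by presburger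
      have "digit_sum 2 (N div 3) = digit_sum 2 (n div 3) + a div 2 + 1"
        unfolding sN 3 c by simp
      moreover have "digit_sum 2 (K div 3) = digit_sum 2 A + v div 2"
        \<comment> \<open>Now \<open>X mod 3\<close> is 2 for even \<open>v\<close> and 1 for odd
          \<open>v\<close>, giving \<open>v div 2\<close> ones in both cases.\<close>
        unfolding sK XK K3 3 by auto
      ultimately have "multiplicity 2 (fibonomial N n) + a div 2
          = 1 + of_bool (odd n) + digit_sum 2 A + v div 2"
        using main unfolding gN by simp
      then show ?thesis
        unfolding N_def[symmetric] n6 dvd_eq_mod_eq_0[of 3] 3 using v0 by auto
    qed
  }
qed

section \<open>Translation to real numbers, floors and ceilings\<close>

lemma ceiling_half_nat: "\<lceil>real k / 2\<rceil> = int ((k + 1) div 2)"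
  by (cases "even k") (auto elim!: evenE oddE simp: ceiling_eq_iff field_simps)

theorem theorem7:
  fixes a n A :: nat and \<epsilon> \<delta>\<^sub>0 \<delta>\<^sub>1 :: real
  assumes "a > 0" and "n > 0"
    and "\<epsilon> = of_bool (\<not> [n = 0] (mod 3))"
    and "A = nat \<lfloor>(2 ^ a - 1) * real n / (3 * 2 ^ multiplicity 2 n)\<rfloor>"
    and "\<delta>\<^sub>0 = (if [n = 3] (mod 6) \<or> [n = 5] (mod 6) then 1 else 0)"
    and "\<delta>\<^sub>1 = (real (n mod 6) - 1) / 2 * of_bool (\<not> 2 dvd n)
             + real_of_int \<lceil>(real (multiplicity 2 n) + 3 - real (n mod 3)) / 2\<rceil>
               * of_bool (n mod 6 \<in> {2, 4})"
  shows "(even a \<longrightarrow>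
            real (multiplicity 2 (fibonomial (2 ^ a * n) n))
              = \<delta>\<^sub>0 + real A - real a / 2 * \<epsilon> - real (multiplicity 2 (fact A :: nat))
          \<and> \<delta>\<^sub>0 + real A - real a / 2 * \<epsilon> - real (multiplicity 2 (fact A :: nat))
              = \<delta>\<^sub>0 + real (digit_sum 2 A) - real a / 2 * \<epsilon>)
       \<and> (odd a \<longrightarrow>
            real (multiplicity 2 (fibonomial (2 ^ a * n) n))
              = \<delta>\<^sub>1 + real A - (real a - 1) / 2 * \<epsilon> - real (multiplicity 2 (fact A :: nat))
          \<and> \<delta>\<^sub>1 + real A - (real a - 1) / 2 * \<epsilon> - real (multiplicity 2 (fact A :: nat))
              = \<delta>\<^sub>1 + real (digit_sum 2 A) - (real a - 1) / 2 * \<epsilon>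
          \<and> (odd n \<longrightarrow> \<delta>\<^sub>1 = (real (n mod 6) - 1) / 2)
          \<and> ([n = 0] (mod 6) \<longrightarrow> \<delta>\<^sub>1 = 0)
          \<and> ([n = 4] (mod 6) \<longrightarrow> \<delta>\<^sub>1 = real_of_int \<lceil>real (multiplicity 2 n) / 2\<rceil> + 1)
          \<and> ([n = 2] (mod 6) \<longrightarrow> \<delta>\<^sub>1 = real_of_int \<lceil>(real (multiplicity 2 n) + 1) / 2\<rceil>))"
proof -
  define v where "v = multiplicity 2 n"
  define F where "F = multiplicity 2 (fibonomial (2 ^ a * n) n)"
  let ?d = "if odd n then n mod 6 div 2 else if n mod 6 = 0 then 0
    else if n mod 6 = 4 then (v + 1) div 2 + 1 else (v + 2) div 2"
  have n: "n = 2 ^ v * (n div 2 ^ v)"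
    unfolding v_def by (simp add: multiplicity_dvd)
  \<comment> \<open>As \<open>2 ^ v\<close> divides \<open>n\<close> exactly, the floor defining
    \<open>A\<close> is a natural-number quotient by 3.\<close>
  have "(2 ^ a - 1) * real n / (3 * 2 ^ v) = real ((2 ^ a - 1) * (n div 2 ^ v)) / real 3"
    by (subst n) (simp add: of_nat_diff field_simps)
  then have A: "A = (2 ^ a - 1) * (n div 2 ^ v) div 3"
    using assms(4) unfolding v_def[symmetric] by (simp only: floor_divide_of_nat_eq nat_int)
  have \<epsilon>: "\<epsilon> = of_bool (\<not> 3 dvd n)"
    using assms(3) by (simp add: cong_0_iff)
  have \<delta>0: "\<delta>\<^sub>0 = real (of_bool (n mod 6 \<in> {3, 5}))"
    using assms(5) by (simp add: cong_def)
  \<comment> \<open>The numerator \<open>v + 3 - n mod 3\<close> of the ceiling in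
    \<open>\<delta>\<^sub>1\<close> is \<open>v + 1\<close> for \<open>n mod 6 = 2\<close> and
    \<open>v + 2\<close> for \<open>n mod 6 = 4\<close>.\<close>
  have c1: "\<lceil>(real v + 1) / 2\<rceil> = int ((v + 2) div 2)"
    using ceiling_half_nat[of "v + 1"] by (simp add: add.commute)
  have c2: "\<lceil>(real v + 2) / 2\<rceil> = int ((v + 1) div 2 + 1)"
    using ceiling_half_nat[of "v + 2"] by (simp add: add.commute)
  have n6: "n mod 6 = 0 \<and> n mod 3 = 0 \<and> even n \<or> n mod 6 = 1 \<and> odd n \<or>
      n mod 6 = 2 \<and> n mod 3 = 2 \<and> even n \<or> n mod 6 = 3 \<and> odd n \<or>
      n mod 6 = 4 \<and> n mod 3 = 1 \<and> even n \<or> n mod 6 = 5 \<and> odd n"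
    by presburger
  have \<delta>1: "\<delta>\<^sub>1 = real ?d"
    using n6 c1 c2 unfolding assms(6) v_def[symmetric] by (elim disjE) (auto simp: add.commute)
  have legendre: "real A - real (multiplicity 2 (fact A :: nat)) = real (digit_sum 2 A)"
    using digit_sum_two_add_multiplicity_fact[of A] by linarith
  have even: "real F = \<delta>\<^sub>0 + real (digit_sum 2 A) - real a / 2 * \<epsilon>" if "even a"
  proof -
    have "F + a div 2 * of_bool (\<not> 3 dvd n) = of_bool (n mod 6 \<in> {3, 5}) + digit_sum 2 A"
      using multiplicity_two_fibonomial_power_two(1)[OF assms(1,2) that]
      unfolding F_def A v_def .
    then have "real F + real (a div 2) * \<epsilon> = \<delta>\<^sub>0 + real (digit_sum 2 A)"
      unfolding \<epsilon> \<delta>0 by (metis of_nat_add of_nat_mult of_nat_of_bool)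
    moreover have "real (a div 2) = real a / 2"
      using that by (simp add: real_of_nat_div)
    ultimately show ?thesis by simp
  qed
  have odd: "real F = \<delta>\<^sub>1 + real (digit_sum 2 A) - (real a - 1) / 2 * \<epsilon>" if "odd a"
  proof -
    have "F + a div 2 * of_bool (\<not> 3 dvd n) = ?d + digit_sum 2 A"
      using multiplicity_two_fibonomial_power_two(2)[OF assms(1,2) that]
      unfolding F_def A v_def .
    then have "real F + real (a div 2) * \<epsilon> = \<delta>\<^sub>1 + real (digit_sum 2 A)"
      unfolding \<epsilon> \<delta>1 by (metis of_nat_add of_nat_mult of_nat_of_bool)
    moreover have "real (a div 2) = (real a - 1) / 2"
      using that by (auto elim!: oddE)
    ultimately show ?thesis by simp
  qed
  have "odd n \<longrightarrow> \<delta>\<^sub>1 = (real (n mod 6) - 1) / 2"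
    unfolding \<delta>1 using n6 by auto
  moreover have "[n = 0] (mod 6) \<longrightarrow> \<delta>\<^sub>1 = 0"
    unfolding \<delta>1 cong_def using n6 by auto
  moreover have "[n = 4] (mod 6) \<longrightarrow> \<delta>\<^sub>1 = real_of_int \<lceil>real (multiplicity 2 n) / 2\<rceil> + 1"
    unfolding \<delta>1 cong_def v_def[symmetric] ceiling_half_nat using n6 by auto
  moreover have "[n = 2] (mod 6) \<longrightarrow> \<delta>\<^sub>1 = real_of_int \<lceil>(real (multiplicity 2 n) + 1) / 2\<rceil>"
    unfolding \<delta>1 cong_def v_def[symmetric] c1 using n6 by auto
  ultimately show ?thesis
    using even odd legendre unfolding F_def[symmetric] by simp
qed

end
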